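(* (i) For every $q>0$, the function $p\mapsto \pi_{p,q}$ is strictly geometrically convex and log-convex on $(0,\infty)$. Consequently, for all $\alpha\in(0,1)$ and $p_1,p_2,q>0$ with $p_1\neq p_2$, $$\pi_{p_1^{\alpha}p_2^{1-\alpha},\,q}<\pi_{p_1,q}^{\alpha}\,\pi_{p_2,q}^{1-\alpha},\qquad \pi_{\alpha p_1+(1-\alpha)p_2,\,q}<\pi_{p_1,q}^{\alpha}\,\pi_{p_2,q}^{1-\alpha},\qquad \pi_{p_1^{\alpha}p_2^{1-\alpha},\,q}<\alpha\,\pi_{p_1,q}+(1-\alpha)\,\pi_{p_2,q},$$ and, for all $s>1$ and $q>0$, $$\pi_{s,q}^2<\pi_{s-1,q}\,\pi_{s+1,q}.$$ (ii) For every $p>0$, the function $q\mapsto \pi_{p,q}$ is strictly log-convex on $(0,\infty)$, and for all $s>1$ and $p>0$, $$\pi_{p,s}^2<\pi_{p,s-1}\,\pi_{p,s+1}.$$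
   Context: For $p,q>0$ and $x\in(0,1)$ let $\arcsin_{p,q}(x)=\int_0^x(1-t^q)^{-1/p}\,dt$, and define $\pi_{p,q}$ by $$\frac{\pi_{p,q}}{2}=\arcsin_{p,q}(1)=\int_0^1(1-t^q)^{-1/p}\,dt.$$ A function $f:(0,\infty)\to(0,\infty)$ is log-convex if $f(\lambda u+(1-\lambda)v)\le f(u)^{\lambda}f(v)^{1-\lambda}$ for all $u,v>0$ and $\lambda\in[0,1]$; it is geometrically convex if $f(u^{\lambda}v^{1-\lambda})\le f(u)^{\lambda}f(v)^{1-\lambda}$ for all $u,v>0$ and $\lambda\in[0,1]$. The property is strict if the inequality is strict whenever $u\ne v$ and $\lambda\in(0,1)$.
   Formalization: Since the integral for π_{p,q} diverges exactly for p≤1, π_{p,q} takes values in (0,∞], and the strict inequalities (also in strict convexity) are claimed only where the left-hand side is finite, i.e. its first index exceeds 1 (so p>1 in the last inequality of (ii)). *)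

theory Defs
  imports "HOL-Analysis.Analysis"
begin

(* The defining integral diverges exactly for p \<le> 1 (see pi_pq_finite_iff), so it is taken with
   values in [0, \<infinity>] and not as a total real-valued integral, which would silently be 0 there. *)

definition arcsin_pq :: "real \<Rightarrow> real \<Rightarrow> real \<Rightarrow> ennreal" where
  "arcsin_pq p q x = (\<integral>\<^sup>+ t \<in> {0<..<x}. ennreal ((1 - t powr q) powr (- 1 / p)) \<partial>lborel)"

definition pi_pq :: "real \<Rightarrow> real \<Rightarrow> ennreal" where
  "pi_pq p q = 2 * arcsin_pq p q 1"

(* Only used with exponents a \<ge> 0; \<infinity> to the power 0 is 1. *)
definition epowr :: "ennreal \<Rightarrow> real \<Rightarrow> ennreal"  (infixr \<open>epowr\<close> 80) where
  "x epowr a =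
     (if x = \<infinity> then (if a = 0 then 1 else \<infinity>) else ennreal (enn2real x powr a))"

(* Convexity of functions (0, \<infinity>) \<rightarrow> (0, \<infinity>].  As usual for extended-valued functions, strictness is
   demanded only where the left-hand side is finite; if f is finite everywhere, these are
   literally the usual notions. *)

definition log_convex :: "(real \<Rightarrow> ennreal) \<Rightarrow> bool" where
  "log_convex f \<longleftrightarrow> (\<forall>u>0. 0 < f u) \<and>
     (\<forall>u>0. \<forall>v>0. \<forall>l\<in>{0..1}.
        f (l * u + (1 - l) * v) \<le> f u epowr l * f v epowr (1 - l))"

definition strictly_log_convex :: "(real \<Rightarrow> ennreal) \<Rightarrow> bool" where
  "strictly_log_convex f \<longleftrightarrow> log_convex f \<and>
     (\<forall>u>0. \<forall>v>0. \<forall>l\<in>{0<..<1}. u \<noteq> v \<longrightarrow> f (l * u + (1 - l) * v) < \<infinity> \<longrightarrow>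
        f (l * u + (1 - l) * v) < f u epowr l * f v epowr (1 - l))"

definition geometrically_convex :: "(real \<Rightarrow> ennreal) \<Rightarrow> bool" where
  "geometrically_convex f \<longleftrightarrow> (\<forall>u>0. 0 < f u) \<and>
     (\<forall>u>0. \<forall>v>0. \<forall>l\<in>{0..1}.
        f (u powr l * v powr (1 - l)) \<le> f u epowr l * f v epowr (1 - l))"

definition strictly_geometrically_convex :: "(real \<Rightarrow> ennreal) \<Rightarrow> bool" where
  "strictly_geometrically_convex f \<longleftrightarrow> geometrically_convex f \<and>
     (\<forall>u>0. \<forall>v>0. \<forall>l\<in>{0<..<1}. u \<noteq> v \<longrightarrow> f (u powr l * v powr (1 - l)) < \<infinity> \<longrightarrow>
        f (u powr l * v powr (1 - l)) < f u epowr l * f v epowr (1 - l))"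

lemma one_minus_powr_bounds:
  fixes t q :: real
  assumes "0 < q" "0 < t" "t < 1"
  shows "min 1 q * (1 - t) \<le> 1 - t powr q" "1 - t powr q \<le> max 1 q * (1 - t)"
proof -
  have "\<exists>z. t < z \<and> z < 1 \<and> 1 powr q - t powr q = (1 - t) * (q * z powr (q - 1))"
    using assms by (intro MVT2) (auto intro!: derivative_eq_intros)
  then obtain z where z: "t < z" "z < 1" "1 - t powr q = (1 - t) * (q * z powr (q - 1))" by auto
  have "min 1 q * (1 - t) \<le> 1 - t powr q \<and> 1 - t powr q \<le> max 1 q * (1 - t)"
  proof (cases "q \<le> 1")
    case True
    then have "z powr (q - 1) \<ge> 1" using z assms powr_mono'[of "q - 1" 0 z] by simp
    then have "q * (1 - t) \<le> q * ((1 - t) * z powr (q - 1))"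
      using assms by simp
    then have "q * (1 - t) \<le> 1 - t powr q" using z(3) by (simp add: mult_ac)
    moreover have "t powr q \<ge> t" using powr_mono'[of q 1 t] True assms by simp
    ultimately show ?thesis using True assms by (simp add: max_def min_def)
  next
    case False
    then have "z powr (q - 1) \<le> 1" using z assms powr_mono'[of 0 "q - 1" z] by simp
    then have "q * ((1 - t) * z powr (q - 1)) \<le> q * (1 - t)"
      using assms by simp
    then have "1 - t powr q \<le> q * (1 - t)" using z(3) by (simp add: mult_ac)
    moreover have "t powr q \<le> t" using powr_mono'[of 1 q t] False assms by simp
    ultimately show ?thesis using False assms by (simp add: max_def min_def)
  qed
  then show "min 1 q * (1 - t) \<le> 1 - t powr q" "1 - t powr q \<le> max 1 q * (1 - t)" by auto
qed

lemma pi_pq_finite_iff: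
  assumes "0 < p" "0 < q"
  shows "pi_pq p q < \<infinity> \<longleftrightarrow> 1 < p"
proof
  assume p: "1 < p"
  define m where "m = min 1 q"
  have m: "m > 0" using assms by (simp add: m_def)
  let ?g = "\<lambda>t::real. m powr (- 1 / p) * (t powr (1 - 1) * (1 - t) powr ((1 - 1 / p) - 1))"
  have "set_integrable lborel {0..1} (\<lambda>t::real. t powr (1 - 1) * (1 - t) powr ((1 - 1 / p) - 1))"
    using p by (intro integrable_Beta) auto
  then have "set_integrable lborel {0..1} ?g" by (rule set_integrable_mult_right) 
  then have fin: "(\<integral>\<^sup>+ t. norm (indicator {0..1} t *\<^sub>R ?g t) \<partial>lborel) < \<infinity>"
    unfolding set_integrable_def integrable_iff_bounded by simp
  have "arcsin_pq p q 1 \<le> (\<integral>\<^sup>+ t. norm (indicator {0..1} t *\<^sub>R ?g t) \<partial>lborel)"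
    unfolding arcsin_pq_def
  proof (intro nn_integral_mono)
    fix t :: real
    show "ennreal ((1 - t powr q) powr (- 1 / p)) * indicator {0<..<1} t
            \<le> ennreal (norm (indicator {0..1} t *\<^sub>R ?g t))"
    proof (cases "0 < t \<and> t < 1")
      case True
      have "(1 - t powr q) powr (- 1 / p) \<le> (m * (1 - t)) powr (- 1 / p)"
        using one_minus_powr_bounds[of q t] True assms m p
        by (intro powr_mono2') (auto simp: m_def[symmetric])
      also have "\<dots> = ?g t" using True m by (simp add: powr_mult)
      finally show ?thesis using True by (simp add: abs_mult)
    qed auto
  qed
  then have "arcsin_pq p q 1 < \<infinity>" using fin by (rule le_less_trans)
  then show "pi_pq p q < \<infinity>"
    by (simp add: pi_pq_def ennreal_mult_less_top)
next
  assume fin: "pi_pq p q < \<infinity>"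
  show "1 < p"
  proof (rule ccontr)
    assume "\<not> 1 < p"
    then have p: "1 \<le> 1 / p" using assms by simp
    define M where "M = max 1 q"
    have M: "M \<ge> 1" by (simp add: M_def)
    have low: "ennreal (c / M) \<le> arcsin_pq p q 1" if "c > 0" for c :: real
    proof -
      define b where "b = 1 - exp (- c)"
      have b: "0 < b" "b < 1" using that by (auto simp: b_def)
      have "(\<integral>\<^sup>+ t. ennreal (1 / (M * (1 - t))) * indicator {0..b} t \<partial>lborel)
              = ennreal (- (ln (1 - b) / M) - - (ln (1 - 0) / M))"
      proof (rule nn_integral_FTC_Icc)
        show "((\<lambda>t. - (ln (1 - t) / M)) has_real_derivative 1 / (M * (1 - t))) (at t)"
          if "t \<in> {0..b}" for t :: real
          using that b M by (auto intro!: derivative_eq_intros simp: field_simps)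
        show "0 \<le> 1 / (M * (1 - t))" if "t \<in> {0..b}" for t :: real
          using that b M by auto
      qed (use b in auto)
      also have "\<dots> = ennreal (c / M)" by (simp add: b_def)
      finally have "ennreal (c / M) 
          = (\<integral>\<^sup>+ t. ennreal (1 / (M * (1 - t))) * indicator {0..b} t \<partial>lborel)" ..
      also have "\<dots> \<le> arcsin_pq p q 1" unfolding arcsin_pq_def
      proof (intro nn_integral_mono_AE)
        have "AE t in lborel. t \<noteq> (0::real)" by (rule AE_lborel_singleton)
        then show "AE t in lborel. ennreal (1 / (M * (1 - t))) * indicator {0..b} t
               \<le> ennreal ((1 - t powr q) powr (- 1 / p)) * indicator {0<..<1} t"
        proof eventually_elim
          fix t :: real assume t0: "t \<noteq> 0"
          show "ennreal (1 / (M * (1 - t))) * indicator {0..b} t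
               \<le> ennreal ((1 - t powr q) powr (- 1 / p)) * indicator {0<..<1} t"
          proof (cases "t \<in> {0..b}")
            case True
            then have t: "0 < t" "t < 1" using b t0 by auto
            have w: "1 - t powr q \<le> M * (1 - t)" "0 < 1 - t powr q"
              using one_minus_powr_bounds[of q t] t assms
              powr_less_mono2[of q t 1]
              by (auto simp: M_def[symmetric])
            have "1 / (M * (1 - t)) \<le> 1 / (1 - t powr q)"
              using w by (intro divide_left_mono) (auto intro!: mult_pos_pos)
            also have "\<dots> = (1 - t powr q) powr (- 1)"
              using w by (simp add: powr_minus_divide)
            also have "\<dots> \<le> (1 - t powr q) powr (- 1 / p)"
              using w p by (intro powr_mono') auto
            finally show ?thesis using True t by (auto intro: ennreal_leI)
          qed auto
        qed
      qed
      finally show ?thesis .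
    qed
    have "arcsin_pq p q 1 < \<infinity>"
      using fin by (auto simp: pi_pq_def ennreal_mult_less_top)
    then obtain r where r: "r \<ge> 0" "arcsin_pq p q 1 = ennreal r"
      by (cases "arcsin_pq p q 1") auto
    show False using low[of "M * (r + 1)"] r M by simp
  qed
qed

end

(* The integrand (1 - t^q)^(-1/p) is, for each fixed t in (0,1), strictly log-convex in p and in q and
   strictly geometrically convex in p, and Hoelder's inequality carries this over to the
   integral.  In p this is the strict convexity of 1/p and of exp(-x); in q it is
   x^l y^(1-l) + (1-x)^l (1-y)^(1-l) < 1 for x = t^u and y = t^v, which is the sum of two instances of
   the weighted AM-GM inequality. *)
theory Submission
  imports Defs
begin

section \<open>Weighted AM-GM and real powers of extended nonnegative reals\<close>

text \<open>Apply \<open>ln x \<le> x - 1\<close> to the quotients of \<open>a\<close> and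
  \<open>b\<close> by their geometric mean \<open>r\<close>. The weighted logarithms of these
  quotients sum to 0, and strictness comes from \<open>a \<noteq> r\<close>.\<close>

lemma weighted_am_gm_less:
  fixes a b l :: real
  assumes "0 < l" "l < 1" "0 < a" "0 < b" "a \<noteq> b"
  shows "a powr l * b powr (1 - l) < l * a + (1 - l) * b"
proof -
  define r where "r = a powr l * b powr (1 - l)"
  have r: "r > 0" using assms by (simp add: r_def)
  have lnr: "ln r = l * ln a + (1 - l) * ln b"
    using assms by (simp add: r_def ln_mult ln_powr)
  have "a \<noteq> r"
  proof
    assume "a = r"
    then have "(1 - l) * (ln a - ln b) = 0" using lnr by (simp add: algebra_simps)
    then show False using assms by simp
  qed
  then have "ln (a / r) < a / r - 1"
    using ln_le_minus_one[of "a / r"] ln_eq_minus_one[of "a / r"] assms r by force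
  then have "l * ln (a / r) < l * (a / r - 1)" using assms by simp
  moreover have "(1 - l) * ln (b / r) \<le> (1 - l) * (b / r - 1)"
    using ln_le_minus_one[of "b / r"] assms r by (intro mult_left_mono) auto
  moreover have "l * ln (a / r) + (1 - l) * ln (b / r) = 0"
    using assms r lnr by (simp add: ln_div algebra_simps)
  ultimately have "0 < l * (a / r - 1) + (1 - l) * (b / r - 1)" by linarith
  then have "1 < (l * a + (1 - l) * b) / r"
    by (simp add: algebra_simps add_divide_distrib diff_divide_distrib)
  then show ?thesis using r by (simp add: r_def[symmetric] field_simps)
qed

lemma weighted_am_gm:
  fixes a b l :: real
  assumes "0 \<le> l" "l \<le> 1" "0 < a" "0 < b"
  shows "a powr l * b powr (1 - l) \<le> l * a + (1 - l) * b"
  using Youngs_inequality_0[of l "1 - l" a b] assms by simp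

lemma epowr_1 [simp]: "x epowr 1 = x"
  by (simp add: epowr_def less_top)

text \<open>Positivity matters because \<open>0 powr 0 = 0\<close>.\<close>

lemma epowr_0 [simp]: "0 < x \<Longrightarrow> x epowr 0 = 1"
  by (auto simp: epowr_def less_top enn2real_eq_0_iff)

lemma epowr_ennreal: "0 \<le> r \<Longrightarrow> ennreal r epowr a = ennreal (r powr a)"
  by (simp add: epowr_def)

lemma epowr_neq_0: "0 < x \<Longrightarrow> x epowr a \<noteq> 0"
  by (cases x) (auto simp: epowr_def enn2real_eq_0_iff)

text \<open>Handles parameters where the integral diverges. Positivity of both factors rules out the
  product \<open>\<infinity> * 0\<close>, which is 0 in \<open>ennreal\<close>.\<close>

lemma epowr_mult_eq_top:
  assumes "0 < x" "0 < y" "0 < l" "l < 1" "x = \<infinity> \<or> y = \<infinity>"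
  shows "x epowr l * y epowr (1 - l) = \<infinity>"
  using assms epowr_neq_0[of x l] epowr_neq_0[of y "1 - l"]
  by (auto simp: epowr_def ennreal_mult_eq_top_iff)

lemma epowr_mult_same:
  assumes "0 < x" "0 < l" "l < 1"
  shows "x epowr l * x epowr (1 - l) = x"
proof (cases x)
  case (real r)
  then show ?thesis using assms
    by (simp add: epowr_ennreal flip: ennreal_mult powr_add)
next
  case top
  then show ?thesis using epowr_mult_eq_top[OF assms(1,1,2,3)] by simp
qed

lemma weighted_am_gm_epowr:
  assumes "0 < l" "l < 1" "0 < x" "0 < y"
  shows "x epowr l * y epowr (1 - l) \<le> ennreal l * x + ennreal (1 - l) * y"
proof (cases "x = \<infinity> \<or> y = \<infinity>")
  case True
  then show ?thesis using assms by (auto simp: ennreal_mult_top)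
next
  case False
  then obtain a b where ab: "0 < a" "0 < b" "x = ennreal a" "y = ennreal b"
    using assms by (cases x; cases y) auto
  then show ?thesis
    using weighted_am_gm[of l a b] assms
    by (simp add: epowr_ennreal flip: ennreal_mult ennreal_plus)
qed

lemma epowr_half_square: "(x epowr (1/2) * y epowr (1/2))\<^sup>2 = x * y"
proof -
  have "(z epowr (1/2))\<^sup>2 = z" for z
  proof (cases z)
    case (real r)
    then show ?thesis by (simp add: epowr_ennreal ennreal_power powr_half_sqrt)
  qed (simp add: epowr_def power2_eq_square)
  then show ?thesis by (simp add: power_mult_distrib)
qed

lemma ennreal_square_less:
  fixes x y :: ennreal
  assumes "x < y"
  shows "x\<^sup>2 < y\<^sup>2"
  using assms
  by (cases x; cases y) (auto simp: ennreal_power ennreal_less_iff power_strict_mono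
      top_power_ennreal less_top)

section \<open>Hoelder's inequality with possibly infinite integrals\<close>

text \<open>The conjugate exponents are \<open>1 / l\<close> and \<open>1 / (1 - l)\<close>. If both
  integrals are finite, normalise \<open>f\<close> and \<open>g\<close> by them, apply weighted
  AM-GM pointwise and integrate; otherwise the right-hand side is infinite.\<close>

lemma Hoelder_nn_integral:
  fixes f g :: "'a \<Rightarrow> real"
  assumes [measurable]: "f \<in> borel_measurable M" "g \<in> borel_measurable M"
    and pos: "\<And>x. x \<in> space M \<Longrightarrow> 0 < f x" "\<And>x. x \<in> space M \<Longrightarrow> 0 < g x"
    and l: "0 < l" "l < 1"
    and AB: "0 < (\<integral>\<^sup>+x. f x \<partial>M)" "0 < (\<integral>\<^sup>+x. g x \<partial>M)"
  shows "(\<integral>\<^sup>+x. f x powr l * g x powr (1 - l) \<partial>M)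
           \<le> (\<integral>\<^sup>+x. f x \<partial>M) epowr l * (\<integral>\<^sup>+x. g x \<partial>M) epowr (1 - l)"
proof (cases "(\<integral>\<^sup>+x. f x \<partial>M) = \<infinity> \<or> (\<integral>\<^sup>+x. g x \<partial>M) = \<infinity>")
  case True
  then show ?thesis using epowr_mult_eq_top[OF AB l] by simp
next
  case False
  then obtain a b where ab: "0 < a" "0 < b"
    "(\<integral>\<^sup>+x. f x \<partial>M) = ennreal a" "(\<integral>\<^sup>+x. g x \<partial>M) = ennreal b"
    using AB by (cases "\<integral>\<^sup>+x. f x \<partial>M"; cases "\<integral>\<^sup>+x. g x \<partial>M") auto
  define c where "c = a powr l * b powr (1 - l)"
  have c: "c > 0" using ab by (simp add: c_def)
  have "(\<integral>\<^sup>+x. f x powr l * g x powr (1 - l) \<partial>M)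
      \<le> (\<integral>\<^sup>+x. ennreal (c * l / a) * f x + ennreal (c * (1 - l) / b) * g x \<partial>M)"
  proof (intro nn_integral_mono)
    fix x assume x: "x \<in> space M"
    have "f x powr l * g x powr (1 - l) = c * ((f x / a) powr l * (g x / b) powr (1 - l))"
      using ab pos[OF x] by (simp add: c_def powr_divide)
    also have "\<dots> \<le> c * (l * (f x / a) + (1 - l) * (g x / b))"
      using ab pos[OF x] l c by (intro mult_left_mono weighted_am_gm) auto
    also have "\<dots> = c * l / a * f x + c * (1 - l) / b * g x"
      by (simp add: field_simps)
    finally show "ennreal (f x powr l * g x powr (1 - l))
        \<le> ennreal (c * l / a) * f x + ennreal (c * (1 - l) / b) * g x"
      using ab pos[OF x] l c by (simp add: less_imp_le flip: ennreal_mult ennreal_plus)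
  qed
  also have "\<dots> = ennreal (c * l / a) * a + ennreal (c * (1 - l) / b) * b"
    by (simp add: nn_integral_add nn_integral_cmult ab)
  also have "\<dots> = ennreal (c * l / a * a + c * (1 - l) / b * b)"
    using ab l c by (simp flip: ennreal_mult ennreal_plus)
  \<comment> \<open>After normalisation both functions have integral 1, so the weights
    \<open>l\<close> and \<open>1 - l\<close> add up to 1 and only \<open>c\<close> remains.\<close>
  also have "c * l / a * a + c * (1 - l) / b * b = c"
    using ab by (simp add: field_simps)
  finally show ?thesis
    using ab by (simp add: c_def epowr_ennreal ennreal_mult)
qed

section \<open>\<open>pi_pq\<close> as one integral over a measure of mass 2\<close>

text \<open>Absorbs the factor 2 and the indicator of (0,1). On this restricted space the integrand
  is positive everywhere, as \<open>Hoelder_nn_integral\<close> demands.\<close>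

definition pi_measure :: "real measure" where
  "pi_measure = scale_measure 2 (restrict_space lborel {0<..<1})"

lemma space_pi_measure [simp]: "space pi_measure = {0<..<1}"
  by (simp add: pi_measure_def space_restrict_space space_scale_measure)

lemma borel_measurable_pi_measure [measurable (raw)]:
  "f \<in> borel_measurable borel \<Longrightarrow> f \<in> borel_measurable pi_measure"
  unfolding pi_measure_def measurable_cong_sets[OF sets_scale_measure refl]
  by (rule measurable_restrict_space1) simp

lemma emeasure_pi_measure: "emeasure pi_measure {0<..<1} = 2"
  by (simp add: pi_measure_def emeasure_restrict_space)

lemma pi_pq_eq: "pi_pq p q = (\<integral>\<^sup>+t. (1 - t powr q) powr (- 1 / p) \<partial>pi_measure)"
  unfolding pi_pq_def arcsin_pq_def pi_measure_def
  by (subst nn_integral_scale_measure)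
     (auto simp: nn_integral_restrict_space intro!: measurable_restrict_space1)

lemma powr_less_one_of_less_one:
  fixes t q :: real
  assumes "0 < q" "0 < t" "t < 1"
  shows "t powr q < 1"
  using powr_less_mono2[of q t 1] assms by simp

text \<open>The integrand is at least 1 on (0,1), so the integral is at least the total mass
  2.\<close>

lemma pi_pq_pos:
  assumes "0 < p" "0 < q"
  shows "0 < pi_pq p q"
proof -
  have "(\<integral>\<^sup>+t. 1 \<partial>pi_measure) \<le> pi_pq p q"
    unfolding pi_pq_eq
  proof (intro nn_integral_mono)
    fix t assume "t \<in> space pi_measure"
    then have t: "0 < t" "t < 1" by auto
    have "1 \<le> (1 - t powr q) powr (- 1 / p)"
      using powr_mono2'[of "- 1 / p" "1 - t powr q" 1] powr_less_one_of_less_one[OF assms(2) t] assms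
      by simp
    then show "1 \<le> ennreal ((1 - t powr q) powr (- 1 / p))" by simp
  qed
  moreover have "(\<integral>\<^sup>+t. 1 \<partial>pi_measure) = 2" using emeasure_pi_measure by simp
  ultimately show ?thesis by (metis less_le_trans zero_less_numeral)
qed

text \<open>Reduces both parts of the theorem to a strict inequality between integrands at each
  \<open>t\<close>. Integrating it gives strictness as long as the smaller integral is finite, and
  Hoelder's inequality bounds the larger one. Two pairs of parameters are allowed so that either
  \<open>p\<close> or \<open>q\<close> can vary.\<close>

lemma pi_pq_Hoelder_less:
  assumes pos: "0 < p1" "0 < q1" "0 < p2" "0 < q2" and l: "0 < l" "l < 1"
    and less: "\<And>t. 0 < t \<Longrightarrow> t < 1 \<Longrightarrow> (1 - t powr q) powr (- 1 / p)
      < (1 - t powr q1) powr (- 1 / p1 * l) * (1 - t powr q2) powr (- 1 / p2 * (1 - l))"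
  shows "pi_pq p q \<le> pi_pq p1 q1 epowr l * pi_pq p2 q2 epowr (1 - l)"
    and "pi_pq p q < \<infinity> \<Longrightarrow> pi_pq p q < pi_pq p1 q1 epowr l * pi_pq p2 q2 epowr (1 - l)"
proof -
  define f where "f = (\<lambda>p q t::real. (1 - t powr q) powr (- 1 / p))"
  have f_eq: "pi_pq p q = (\<integral>\<^sup>+t. f p q t \<partial>pi_measure)" for p q
    by (simp add: pi_pq_eq f_def)
  have [measurable]: "f p q \<in> borel_measurable pi_measure" for p q
    unfolding f_def by (intro borel_measurable_pi_measure) measurable
  have lt: "f p q t < f p1 q1 t powr l * f p2 q2 t powr (1 - l)" if "t \<in> space pi_measure" for t
    using less[of t] that by (simp add: f_def powr_powr)
  have fpos: "0 < f p q t" if "t \<in> space pi_measure" "0 < p" "0 < q" for p q t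
    using that powr_less_one_of_less_one[of q t] by (auto simp: f_def)
  have H: "(\<integral>\<^sup>+t. f p1 q1 t powr l * f p2 q2 t powr (1 - l) \<partial>pi_measure)
      \<le> pi_pq p1 q1 epowr l * pi_pq p2 q2 epowr (1 - l)"
    unfolding f_eq using pos l pi_pq_pos fpos
    by (intro Hoelder_nn_integral) (auto simp: f_eq)
  have le: "pi_pq p q \<le> (\<integral>\<^sup>+t. f p1 q1 t powr l * f p2 q2 t powr (1 - l) \<partial>pi_measure)"
    unfolding f_eq using lt by (intro nn_integral_mono ennreal_leI) (simp add: less_imp_le)
  then show "pi_pq p q \<le> pi_pq p1 q1 epowr l * pi_pq p2 q2 epowr (1 - l)" using H by order
  assume fin: "pi_pq p q < \<infinity>"
  have "pi_pq p q < (\<integral>\<^sup>+t. f p1 q1 t powr l * f p2 q2 t powr (1 - l) \<partial>pi_measure)"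
    unfolding f_eq
  proof (rule nn_integral_less)
    show "AE t in pi_measure. ennreal (f p q t) \<le> ennreal (f p1 q1 t powr l * f p2 q2 t powr (1 - l))"
      using lt by (intro AE_I2 ennreal_leI less_imp_le)
    \<comment> \<open>The reverse inequality fails at every point, so it could hold almost
      everywhere only on a null space, whereas the mass is 2.\<close>
    show "\<not> (AE t in pi_measure. ennreal (f p1 q1 t powr l * f p2 q2 t powr (1 - l)) \<le> ennreal (f p q t))"
    proof
      assume "AE t in pi_measure. ennreal (f p1 q1 t powr l * f p2 q2 t powr (1 - l)) \<le> ennreal (f p q t)"
      then have "AE t in pi_measure. False"
        by (rule AE_mp)
          (use lt in \<open>auto intro!: AE_I2 simp: f_def ennreal_le_iff not_le\<close>)
      then show False using emeasure_pi_measure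
        by (simp add: ae_filter_eq_bot_iff flip: trivial_limit_def)
    qed
  qed (use fin f_eq in auto)
  then show "pi_pq p q < pi_pq p1 q1 epowr l * pi_pq p2 q2 epowr (1 - l)" using H by order
qed

section \<open>Dependence on \<open>p\<close>\<close>

text \<open>The base \<open>1 - t powr q\<close> lies in (0,1), so its powers strictly decrease in
  the exponent and only the exponents need comparing. The hypothesis \<open>inv\<close> covers the
  geometric and the arithmetic mean of \<open>p1\<close> and \<open>p2\<close> at once.\<close>

lemma pi_pq_p_less:
  assumes "0 < q" "0 < p1" "0 < p2" "0 < l" "l < 1"
    and inv: "1 / p < l / p1 + (1 - l) / p2"
  shows "pi_pq p q \<le> pi_pq p1 q epowr l * pi_pq p2 q epowr (1 - l)"
    and "pi_pq p q < \<infinity> \<Longrightarrow> pi_pq p q < pi_pq p1 q epowr l * pi_pq p2 q epowr (1 - l)"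
proof -
  have "(1 - t powr q) powr (- 1 / p)
      < (1 - t powr q) powr (- 1 / p1 * l) * (1 - t powr q) powr (- 1 / p2 * (1 - l))"
    if t: "0 < t" "t < 1" for t
  proof -
    define x where "x = 1 - t powr q"
    have x: "0 < x" "x < 1" using powr_less_one_of_less_one[OF assms(1) t] t by (auto simp: x_def)
    have "x powr (- 1 / p) < x powr (- 1 / p1 * l + - 1 / p2 * (1 - l))"
      using inv x by (intro powr_less_mono') (auto simp: algebra_simps)
    then show ?thesis unfolding x_def powr_add .
  qed
  note * = pi_pq_Hoelder_less[OF assms(2,1,3,1,4,5) this]
  show "pi_pq p q \<le> pi_pq p1 q epowr l * pi_pq p2 q epowr (1 - l)"
    and "pi_pq p q < \<infinity> \<Longrightarrow> pi_pq p q < pi_pq p1 q epowr l * pi_pq p2 q epowr (1 - l)"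
    using * by auto
qed

text \<open>The reciprocal of the geometric mean is the geometric mean of the reciprocals, so this
  is AM-GM for \<open>1 / a\<close> and \<open>1 / b\<close>.\<close>

lemma inverse_geometric_mean_less:
  fixes a b l :: real
  assumes "0 < a" "0 < b" "a \<noteq> b" "0 < l" "l < 1"
  shows "1 / (a powr l * b powr (1 - l)) < l / a + (1 - l) / b"
  using weighted_am_gm_less[of l "1 / a" "1 / b"] assms by (simp add: powr_divide)

text \<open>The arithmetic mean dominates the geometric mean, so its reciprocal is no larger and the
  previous bound applies.\<close>

lemma inverse_arithmetic_mean_less:
  fixes a b l :: real
  assumes "0 < a" "0 < b" "a \<noteq> b" "0 < l" "l < 1"
  shows "1 / (l * a + (1 - l) * b) < l / a + (1 - l) / b"
proof -
  have "1 / (l * a + (1 - l) * b) \<le> 1 / (a powr l * b powr (1 - l))"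
    using weighted_am_gm[of l a b] assms by (intro divide_left_mono) (auto intro!: mult_pos_pos add_pos_pos)
  then show ?thesis using inverse_geometric_mean_less[OF assms] by simp
qed

section \<open>Dependence on \<open>q\<close>\<close>

lemma pi_pq_q_less:
  assumes "0 < p" "0 < u" "0 < v" "u \<noteq> v" "0 < l" "l < 1"
  shows "pi_pq p (l * u + (1 - l) * v) \<le> pi_pq p u epowr l * pi_pq p v epowr (1 - l)"
    and "pi_pq p (l * u + (1 - l) * v) < \<infinity> \<Longrightarrow>
      pi_pq p (l * u + (1 - l) * v) < pi_pq p u epowr l * pi_pq p v epowr (1 - l)"
proof -
  have "(1 - t powr (l * u + (1 - l) * v)) powr (- 1 / p)
      < (1 - t powr u) powr (- 1 / p * l) * (1 - t powr v) powr (- 1 / p * (1 - l))"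
    if t: "0 < t" "t < 1" for t
  proof -
    define x y where "x = t powr u" and "y = t powr v"
    have xy: "0 < x" "x < 1" "0 < y" "y < 1"
      using powr_less_one_of_less_one[OF _ t] assms t by (auto simp: x_def y_def)
    have "x \<noteq> y" using assms t by (simp add: x_def y_def powr_inj)
    have "x powr l * y powr (1 - l) < l * x + (1 - l) * y"
      using xy \<open>x \<noteq> y\<close> assms by (intro weighted_am_gm_less)
    moreover have "(1 - x) powr l * (1 - y) powr (1 - l) \<le> l * (1 - x) + (1 - l) * (1 - y)"
      using xy assms by (intro weighted_am_gm) auto
    moreover have "x powr l * y powr (1 - l) = t powr (l * u + (1 - l) * v)"
      by (simp add: x_def y_def powr_powr powr_add mult.commute)
    \<comment> \<open>The two arithmetic means add up to 1; strictness comes from the first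
      instance, where \<open>x \<noteq> y\<close>.\<close>
    ultimately have "(1 - x) powr l * (1 - y) powr (1 - l) < 1 - t powr (l * u + (1 - l) * v)"
      by (simp add: algebra_simps)
    \<comment> \<open>The negative exponent reverses the inequality.\<close>
    then have "(1 - t powr (l * u + (1 - l) * v)) powr (- 1 / p)
        < ((1 - x) powr l * (1 - y) powr (1 - l)) powr (- 1 / p)"
      using xy assms by (intro powr_less_mono2_neg) auto
    then show ?thesis using xy by (simp add: powr_mult powr_powr x_def y_def mult.commute)
  qed
  note * = pi_pq_Hoelder_less[OF assms(1,2,1,3,5,6) this]
  show "pi_pq p (l * u + (1 - l) * v) \<le> pi_pq p u epowr l * pi_pq p v epowr (1 - l)"
    and "pi_pq p (l * u + (1 - l) * v) < \<infinity> \<Longrightarrow>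
      pi_pq p (l * u + (1 - l) * v) < pi_pq p u epowr l * pi_pq p v epowr (1 - l)"
    using * by auto
qed

section \<open>From strict inequalities to the convexity notions and their consequences\<close>

text \<open>Leaves only distinct points and interior weights to check. At the weights 0 and 1 and
  for \<open>u = v\<close> both sides agree, by positivity of \<open>f\<close>.\<close>

lemma strictly_log_convexI:
  assumes pos: "\<And>u. 0 < u \<Longrightarrow> 0 < f u"
    and le: "\<And>u v l. 0 < u \<Longrightarrow> 0 < v \<Longrightarrow> u \<noteq> v \<Longrightarrow> 0 < l \<Longrightarrow> l < 1 \<Longrightarrow>
      f (l * u + (1 - l) * v) \<le> f u epowr l * f v epowr (1 - l)"
    and less: "\<And>u v l. 0 < u \<Longrightarrow> 0 < v \<Longrightarrow> u \<noteq> v \<Longrightarrow> 0 < l \<Longrightarrow> l < 1 \<Longrightarrow>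
      f (l * u + (1 - l) * v) < \<infinity> \<Longrightarrow> f (l * u + (1 - l) * v) < f u epowr l * f v epowr (1 - l)"
  shows "strictly_log_convex f"
proof -
  have "f (l * u + (1 - l) * v) \<le> f u epowr l * f v epowr (1 - l)"
    if "0 < u" "0 < v" "l \<in> {0..1}" for u v l
  proof -
    consider "l = 0" | "l = 1" | "0 < l" "l < 1" "u = v" | "0 < l" "l < 1" "u \<noteq> v"
      using \<open>l \<in> {0..1}\<close> by fastforce
    then show ?thesis
    proof cases
      case 3
      have "l * v + (1 - l) * v = v" by (simp add: algebra_simps)
      then show ?thesis using 3 that pos by (simp add: epowr_mult_same)
    qed (use that le pos in auto)
  qed
  then show ?thesis
    unfolding strictly_log_convex_def log_convex_def using pos less by auto
qed

lemma strictly_geometrically_convexI: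
  assumes pos: "\<And>u. 0 < u \<Longrightarrow> 0 < f u"
    and le: "\<And>u v l. 0 < u \<Longrightarrow> 0 < v \<Longrightarrow> u \<noteq> v \<Longrightarrow> 0 < l \<Longrightarrow> l < 1 \<Longrightarrow>
      f (u powr l * v powr (1 - l)) \<le> f u epowr l * f v epowr (1 - l)"
    and less: "\<And>u v l. 0 < u \<Longrightarrow> 0 < v \<Longrightarrow> u \<noteq> v \<Longrightarrow> 0 < l \<Longrightarrow> l < 1 \<Longrightarrow>
      f (u powr l * v powr (1 - l)) < \<infinity> \<Longrightarrow> f (u powr l * v powr (1 - l)) < f u epowr l * f v epowr (1 - l)"
  shows "strictly_geometrically_convex f"
proof -
  have "f (u powr l * v powr (1 - l)) \<le> f u epowr l * f v epowr (1 - l)"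
    if "0 < u" "0 < v" "l \<in> {0..1}" for u v l
  proof -
    consider "l = 0" | "l = 1" | "0 < l" "l < 1" "u = v" | "0 < l" "l < 1" "u \<noteq> v"
      using \<open>l \<in> {0..1}\<close> by fastforce
    then show ?thesis
    proof cases
      case 3
      have "v powr l * v powr (1 - l) = v" using that by (simp flip: powr_add)
      then show ?thesis using 3 that pos by (simp add: epowr_mult_same)
    qed (use that le pos in auto)
  qed
  then show ?thesis
    unfolding strictly_geometrically_convex_def geometrically_convex_def using pos less by auto
qed

text \<open>Strict log-convexity at \<open>s - 1\<close> and \<open>s + 1\<close> with weight 1/2,
  then squared. The value at \<open>s - 1\<close> may be infinite.\<close>

lemma strictly_log_convex_midpoint:
  assumes "strictly_log_convex f" "1 < s" "f s < \<infinity>"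
  shows "(f s)\<^sup>2 < f (s - 1) * f (s + 1)"
proof -
  have mid: "1/2 * (s - 1) + (1 - 1/2) * (s + 1) = s" by (simp add: field_simps)
  have "0 < s - 1" "0 < s + 1" "s - 1 \<noteq> s + 1" "(1/2::real) \<in> {0<..<1}"
    using assms(2) by auto
  then have "f s < f (s - 1) epowr (1/2) * f (s + 1) epowr (1 - 1/2)"
    using assms(1,3) mid unfolding strictly_log_convex_def by metis
  then show ?thesis
    using ennreal_square_less epowr_half_square[of "f (s - 1)" "f (s + 1)"] by fastforce
qed

text \<open>The guards of the form \<open>1 < ...\<close> keep the left-hand sides finite: for first
  parameter at most 1 the value is \<open>\<infinity>\<close> by \<open>pi_pq_finite_iff\<close>,
  and nothing is strictly above it. In the squared inequality in \<open>p\<close>,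
  \<open>s > 1\<close> already ensures this.\<close>

theorem mainTheorem3:
  shows
    "(\<forall>q>0.
        strictly_geometrically_convex (\<lambda>p. pi_pq p q) \<and>
        strictly_log_convex (\<lambda>p. pi_pq p q)) \<and>
     (\<forall>\<alpha>\<in>{0<..<1}. \<forall>p1>0. \<forall>p2>0. \<forall>q>0. p1 \<noteq> p2 \<longrightarrow>
        (1 < p1 powr \<alpha> * p2 powr (1 - \<alpha>) \<longrightarrow>
           pi_pq (p1 powr \<alpha> * p2 powr (1 - \<alpha>)) q
             < pi_pq p1 q epowr \<alpha> * pi_pq p2 q epowr (1 - \<alpha>)) \<and>
        (1 < \<alpha> * p1 + (1 - \<alpha>) * p2 \<longrightarrow>
           pi_pq (\<alpha> * p1 + (1 - \<alpha>) * p2) q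
             < pi_pq p1 q epowr \<alpha> * pi_pq p2 q epowr (1 - \<alpha>)) \<and>
        (1 < p1 powr \<alpha> * p2 powr (1 - \<alpha>) \<longrightarrow>
           pi_pq (p1 powr \<alpha> * p2 powr (1 - \<alpha>)) q
             < ennreal \<alpha> * pi_pq p1 q + ennreal (1 - \<alpha>) * pi_pq p2 q)) \<and>
     (\<forall>s>1. \<forall>q>0. (pi_pq s q)\<^sup>2 < pi_pq (s - 1) q * pi_pq (s + 1) q) \<and>
     (\<forall>p>0. strictly_log_convex (\<lambda>q. pi_pq p q)) \<and>
     (\<forall>s>1. \<forall>p>0. 1 < p \<longrightarrow> (pi_pq p s)\<^sup>2 < pi_pq p (s - 1) * pi_pq p (s + 1))"
proof -
  have fin: "pi_pq p q < \<infinity>" if "1 < p" "0 < q" for p q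
    using that pi_pq_finite_iff[of p q] by simp
  have geo: "strictly_geometrically_convex (\<lambda>p. pi_pq p q)" if "0 < q" for q
    using that by (intro strictly_geometrically_convexI pi_pq_p_less inverse_geometric_mean_less pi_pq_pos)
  have log_p: "strictly_log_convex (\<lambda>p. pi_pq p q)" if "0 < q" for q
    using that by (intro strictly_log_convexI pi_pq_p_less inverse_arithmetic_mean_less pi_pq_pos)
  have log_q: "strictly_log_convex (\<lambda>q. pi_pq p q)" if "0 < p" for p
    using that by (intro strictly_log_convexI pi_pq_q_less pi_pq_pos)
  have geo_less: "pi_pq (p1 powr \<alpha> * p2 powr (1 - \<alpha>)) q
      < pi_pq p1 q epowr \<alpha> * pi_pq p2 q epowr (1 - \<alpha>)"
    if "\<alpha> \<in> {0<..<1}" "0 < p1" "0 < p2" "0 < q" "p1 \<noteq> p2" "1 < p1 powr \<alpha> * p2 powr (1 - \<alpha>)"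
    for \<alpha> p1 p2 q
    using that geo[of q] fin unfolding strictly_geometrically_convex_def by blast
  have arith_less: "pi_pq (\<alpha> * p1 + (1 - \<alpha>) * p2) q
      < pi_pq p1 q epowr \<alpha> * pi_pq p2 q epowr (1 - \<alpha>)"
    if "\<alpha> \<in> {0<..<1}" "0 < p1" "0 < p2" "0 < q" "p1 \<noteq> p2" "1 < \<alpha> * p1 + (1 - \<alpha>) * p2"
    for \<alpha> p1 p2 q
    using that log_p[of q] fin unfolding strictly_log_convex_def by blast
  have mean_less: "pi_pq (p1 powr \<alpha> * p2 powr (1 - \<alpha>)) q
      < ennreal \<alpha> * pi_pq p1 q + ennreal (1 - \<alpha>) * pi_pq p2 q"
    if "\<alpha> \<in> {0<..<1}" "0 < p1" "0 < p2" "0 < q" "p1 \<noteq> p2" "1 < p1 powr \<alpha> * p2 powr (1 - \<alpha>)"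
    for \<alpha> p1 p2 q
    using geo_less[OF that] weighted_am_gm_epowr[of \<alpha> "pi_pq p1 q" "pi_pq p2 q"] that pi_pq_pos
    by (auto dest: less_le_trans)
  have square_p: "(pi_pq s q)\<^sup>2 < pi_pq (s - 1) q * pi_pq (s + 1) q" if "1 < s" "0 < q" for s q
    using strictly_log_convex_midpoint[OF log_p] fin that by simp
  have square_q: "(pi_pq p s)\<^sup>2 < pi_pq p (s - 1) * pi_pq p (s + 1)" if "1 < s" "1 < p" for s p
    using strictly_log_convex_midpoint[OF log_q] fin that by simp
  show ?thesis
    by (intro conjI ballI allI impI geo log_p log_q geo_less arith_less mean_less square_p square_q)
qed

end
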